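(* Let $f\in\mathcal C$ and $m\in\operatorname{M}(f)$. The graph $G(\mathcal A(f,m))$ is a tree with root $\Delta(f,m)$.
   Context: Notation: $\mathbb N=\{0,1,2,\dots\}$, $p\ge 1$, and $\Lambda=\{e_1,\dots,e_p\}$ is the canonical basis of $\mathbb N^p$; $\langle m\rangle=\{\lambda m\mid\lambda\in\mathbb N\}$. $\mathcal C\subseteq\mathbb N^p$ is a fixed non-negative integer cone (the set of points of $\mathbb N^p$ lying in a finitely generated rational convex cone), with at least $p$ extremal rays. A $\mathcal C$-semigroup is an infinite, finitely generated submonoid $S\subseteq\mathcal C$ of $\mathbb N^p$ such that the minimal integer cone containing $S$ is $\mathcal C$ and $\mathcal H(S)=\mathcal C\setminus S$ is finite. A monomial order $\preceq$ on $\mathbb N^p$ is fixed: a total order compatible with addition with $0\preceq x$ for all $x$; it is assumed that $\{x\in\mathcal C\mid x\preceq k\}$ is finite for every $k\in\mathcal C$. $\operatorname{Fb}(S)=\max_\preceq\mathcal H(S)$ (and $-\sum_i e_i$ if $\mathcal H(S)=\emptyset$), $\operatorname{N}(S)=\{x\in S\mid x\prec\operatorname{Fb}(S)\}$, $\operatorname{m}(S)=\min_\preceq(S\setminus\{0\})$, and the ratio is $\operatorname{r}(S)=\min_\preceq(S\setminus\langle\operatorname{m}(S)\rangle)$. A $\mathcal C$-semigroup $S$ is an $\mathcal A$-semigroup if for every $s\in S$ and $e\in\Lambda$ the set $\{s,s+e\}$ is not contained in $\operatorname{N}(S)$. $\mathcal A(f,m)$ is the set of all $\mathcal A$-semigroups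 $S$ with $\operatorname{Fb}(S)=f$ and $\operatorname{m}(S)=m$. $\Delta(f)=\{0\}\cup\{x\in\mathcal C\mid x\succ f\}$, and, for $f,m\in\mathcal C$ with $f\notin\langle m\rangle$, $\Delta(f,m)=\langle m\rangle\cup\Delta(f)$. $\operatorname{M}(f)=\{m\in\mathcal C\setminus\{0\}\mid m\prec f,\text{ or there is no }z\in\mathcal C\text{ with }f\prec z\prec m\}$. $G(\mathcal A(f,m))$ is the directed graph with vertex set $\mathcal A(f,m)$ in which a pair $(S,T)$ of distinct elements is an edge if and only if $T=S\setminus\{\operatorname{r}(S)\}$. A graph is a tree if there exists a vertex $R$ (the root) such that any vertex $S$ is connected to $R$ by a unique sequence of edges $(S_0,S_1),(S_1,S_2),\dots,(S_{n-1},S_n)$ with $S_0=S$ and $S_n=R$.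
   Formalization: It is additionally assumed that f is not in ⟨m⟩ (needed for Δ(f,m) to be defined) and that m is not in Λ when m ≺ f; in the excluded cases 𝒜(f,m) is empty, so the graph has no root and the claim is false. *)

theory Defs
  imports "HOL-Analysis.Analysis" "Graph_Theory.Arc_Walk"
begin

section \<open>Integer cones\<close>

text \<open>Points of \<open>\<nat>\<^sup>p\<close> are vectors of type \<open>nat ^ 'p\<close>, with \<open>p = CARD('p)\<close>.\<close>

definition real_vec :: "nat ^ 'p \<Rightarrow> real ^ 'p" where
  "real_vec x = (\<chi> i. real (x $ i))"

definition int_vec :: "nat ^ 'p \<Rightarrow> int ^ 'p" where
  "int_vec x = (\<chi> i. int (x $ i))"

definition canonical_basis :: "(nat ^ 'p) set" where
  "canonical_basis = range (\<lambda>i. axis i 1)"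

definition integer_cone :: "(nat ^ 'p) set \<Rightarrow> bool" where
  "integer_cone C \<longleftrightarrow>
     (\<exists>V :: (real ^ 'p) set. finite V \<and> (\<forall>v\<in>V. \<forall>i. v $ i \<in> \<rat>) \<and>
        C = {x. real_vec x \<in> convex_cone hull V})"

text \<open>An integer cone \<open>C\<close> does not determine the rational cone cutting it out of \<open>\<nat>\<^sup>p\<close>;
  its extremal rays are those of the convex cone that \<open>C\<close> generates. The set is finite
  for every integer cone.\<close>

definition extremal_rays :: "(nat ^ 'p) set \<Rightarrow> (real ^ 'p) set set" where
  "extremal_rays C =
     {conic hull {v} | v. v \<noteq> 0 \<and> (conic hull {v}) face_of (convex_cone hull (real_vec ` C))}"


section \<open>Monomial orders\<close>

definition monomial_order :: "(nat ^ 'p \<Rightarrow> nat ^ 'p \<Rightarrow> bool) \<Rightarrow> bool" where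
  "monomial_order le \<longleftrightarrow>
     reflp le \<and> antisymp le \<and> transp le \<and> totalp le \<and>
     (\<forall>x y z. le x y \<longrightarrow> le (x + z) (y + z)) \<and> (\<forall>x. le 0 x)"

definition strict :: "('a \<Rightarrow> 'a \<Rightarrow> bool) \<Rightarrow> 'a \<Rightarrow> 'a \<Rightarrow> bool" where
  "strict le x y \<longleftrightarrow> le x y \<and> x \<noteq> y"

definition min_wrt :: "('a \<Rightarrow> 'a \<Rightarrow> bool) \<Rightarrow> 'a set \<Rightarrow> 'a" where
  "min_wrt le A = (THE x. x \<in> A \<and> (\<forall>y\<in>A. le x y))"

definition max_wrt :: "('a \<Rightarrow> 'a \<Rightarrow> bool) \<Rightarrow> 'a set \<Rightarrow> 'a" where
  "max_wrt le A = (THE x. x \<in> A \<and> (\<forall>y\<in>A. le y x))"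

text \<open>The unique extension of a monomial order to \<open>\<int>\<^sup>p\<close> compatible with addition. It is needed
  only to compare with the conventional Frobenius element \<open>- (\<Sum>i. e\<^sub>i)\<close>, which is not
  in \<open>\<nat>\<^sup>p\<close>.\<close>

definition int_strict :: "(nat ^ 'p \<Rightarrow> nat ^ 'p \<Rightarrow> bool) \<Rightarrow> int ^ 'p \<Rightarrow> int ^ 'p \<Rightarrow> bool" where
  "int_strict le a b \<longleftrightarrow>
     (\<exists>c x y. a + int_vec c = int_vec x \<and> b + int_vec c = int_vec y \<and> strict le x y)"


section \<open>Semigroups in a cone\<close>

definition submonoid :: "(nat ^ 'p) set \<Rightarrow> bool" where
  "submonoid S \<longleftrightarrow> 0 \<in> S \<and> (\<forall>x\<in>S. \<forall>y\<in>S. x + y \<in> S)"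

definition C_semigroup :: "(nat ^ 'p) set \<Rightarrow> (nat ^ 'p) set \<Rightarrow> bool" where
  "C_semigroup C S \<longleftrightarrow>
     S \<subseteq> C \<and> infinite S \<and> submonoid S \<and> (\<exists>G. finite G \<and> S = submonoid hull G) \<and>
     integer_cone C \<and> (\<forall>D. integer_cone D \<and> S \<subseteq> D \<longrightarrow> C \<subseteq> D) \<and>
     finite (C - S)"

definition multiples :: "nat ^ 'p \<Rightarrow> (nat ^ 'p) set" where
  "multiples m = range (\<lambda>k. k *s m)"

definition Fb :: "(nat ^ 'p \<Rightarrow> nat ^ 'p \<Rightarrow> bool) \<Rightarrow> (nat ^ 'p) set \<Rightarrow> (nat ^ 'p) set \<Rightarrow> int ^ 'p" where
  "Fb le C S = (if C - S = {} then - (\<Sum>i\<in>UNIV. axis i 1) else int_vec (max_wrt le (C - S)))"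

definition small_elements ::
  "(nat ^ 'p \<Rightarrow> nat ^ 'p \<Rightarrow> bool) \<Rightarrow> (nat ^ 'p) set \<Rightarrow> (nat ^ 'p) set \<Rightarrow> (nat ^ 'p) set" where
  "small_elements le C S = {x \<in> S. int_strict le (int_vec x) (Fb le C S)}"

definition mult :: "(nat ^ 'p \<Rightarrow> nat ^ 'p \<Rightarrow> bool) \<Rightarrow> (nat ^ 'p) set \<Rightarrow> nat ^ 'p" where
  "mult le S = min_wrt le (S - {0})"

definition ratio :: "(nat ^ 'p \<Rightarrow> nat ^ 'p \<Rightarrow> bool) \<Rightarrow> (nat ^ 'p) set \<Rightarrow> nat ^ 'p" where
  "ratio le S = min_wrt le (S - multiples (mult le S))"

definition A_semigroup ::
  "(nat ^ 'p \<Rightarrow> nat ^ 'p \<Rightarrow> bool) \<Rightarrow> (nat ^ 'p) set \<Rightarrow> (nat ^ 'p) set \<Rightarrow> bool" where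
  "A_semigroup le C S \<longleftrightarrow>
     C_semigroup C S \<and>
     (\<forall>s\<in>S. \<forall>e\<in>canonical_basis. \<not> {s, s + e} \<subseteq> small_elements le C S)"

definition A_semigroups ::
  "(nat ^ 'p \<Rightarrow> nat ^ 'p \<Rightarrow> bool) \<Rightarrow> (nat ^ 'p) set \<Rightarrow> nat ^ 'p \<Rightarrow> nat ^ 'p \<Rightarrow> (nat ^ 'p) set set" where
  "A_semigroups le C f m = {S. A_semigroup le C S \<and> Fb le C S = int_vec f \<and> mult le S = m}"

definition Delta ::
  "(nat ^ 'p \<Rightarrow> nat ^ 'p \<Rightarrow> bool) \<Rightarrow> (nat ^ 'p) set \<Rightarrow> nat ^ 'p \<Rightarrow> (nat ^ 'p) set" where
  "Delta le C f = {0} \<union> {x \<in> C. strict le f x}"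

definition Delta2 ::
  "(nat ^ 'p \<Rightarrow> nat ^ 'p \<Rightarrow> bool) \<Rightarrow> (nat ^ 'p) set \<Rightarrow> nat ^ 'p \<Rightarrow> nat ^ 'p \<Rightarrow> (nat ^ 'p) set" where
  "Delta2 le C f m = multiples m \<union> Delta le C f"

definition M_set ::
  "(nat ^ 'p \<Rightarrow> nat ^ 'p \<Rightarrow> bool) \<Rightarrow> (nat ^ 'p) set \<Rightarrow> nat ^ 'p \<Rightarrow> (nat ^ 'p) set" where
  "M_set le C f =
     {m \<in> C - {0}. strict le m f \<or> \<not> (\<exists>z\<in>C. strict le f z \<and> strict le z m)}"


section \<open>The graph and rooted trees\<close>

definition A_graph ::
  "(nat ^ 'p \<Rightarrow> nat ^ 'p \<Rightarrow> bool) \<Rightarrow> (nat ^ 'p) set \<Rightarrow> nat ^ 'p \<Rightarrow> nat ^ 'p \<Rightarrow>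
     ((nat ^ 'p) set, (nat ^ 'p) set \<times> (nat ^ 'p) set) pre_digraph" where
  "A_graph le C f m =
     \<lparr>verts = A_semigroups le C f m,
      arcs = {(S, T). S \<in> A_semigroups le C f m \<and> T \<in> A_semigroups le C f m \<and>
                      S \<noteq> T \<and> T = S - {ratio le S}},
      tail = fst, head = snd\<rparr>"

definition tree_with_root :: "('a, 'b) pre_digraph \<Rightarrow> 'a \<Rightarrow> bool" where
  "tree_with_root G R \<longleftrightarrow> R \<in> verts G \<and> (\<forall>S\<in>verts G. \<exists>!p. pre_digraph.awalk G S p R)"


section \<open>Degenerate parameters\<close>

text \<open>If \<open>f\<close> is a multiple of \<open>m\<close>, or if \<open>m\<close> is a basis vector below \<open>f\<close>, there are no
  \<open>\<A>\<close>-semigroups with Frobenius element \<open>f\<close> and multiplicity \<open>m\<close>, so the graph has no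
  vertices and no root.\<close>

lemma int_vec_inj: "int_vec x = int_vec y \<longleftrightarrow> x = y"
  by (auto simp: int_vec_def vec_eq_iff)

lemma Fb_notin:
  assumes mo: "monomial_order le" and fin: "finite (C - S)" and Fb: "Fb le C S = int_vec f"
  shows "f \<notin> S"
proof -
  have ne: "C - S \<noteq> {}"
  proof
    assume "C - S = {}"
    then have "- (\<Sum>i\<in>UNIV. axis i 1) = int_vec f"
      using Fb by (simp add: Fb_def)
    then have "(- (\<Sum>i\<in>UNIV. axis i (1::int))) $ j = int_vec f $ j" for j
      by simp
    moreover have "(- (\<Sum>i\<in>UNIV. axis i (1::int))) $ j = - 1" for j :: 'a
      by (simp add: axis_def)
    ultimately show False
      by (simp add: int_vec_def)
  qed
  have "\<exists>x\<in>A. \<forall>y\<in>A. le y x" if "finite A" "A \<noteq> {}" for A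
    using that
  proof (induction A rule: finite_ne_induct)
    case (singleton x)
    then show ?case using mo by (auto simp: monomial_order_def reflp_def)
  next
    case (insert x F)
    then obtain w where w: "w \<in> F" "\<forall>y\<in>F. le y w" by blast
    show ?case
    proof (cases "le x w")
      case True
      then show ?thesis using w by auto
    next
      case False
      then have "le w x"
        using mo unfolding monomial_order_def by (metis reflpD totalpD)
      moreover have "le x x"
        using mo by (auto simp: monomial_order_def reflp_def)
      ultimately show ?thesis
        using w mo unfolding monomial_order_def by (metis insert_iff transpD)
    qed
  qed
  then obtain x where x: "x \<in> C - S" "\<forall>y\<in>C - S. le y x"
    using ne fin by blast
  have "max_wrt le (C - S) = x"
    unfolding max_wrt_def
    by (rule the_equality) (use x mo in \<open>auto simp: monomial_order_def antisymp_def\<close>)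
  then show ?thesis
    using x Fb ne by (auto simp: Fb_def int_vec_inj)
qed

lemma mult_mem:
  assumes mo: "monomial_order le" and fin: "\<And>k. k \<in> C \<Longrightarrow> finite {x \<in> C. le x k}"
    and S: "S \<subseteq> C" "infinite S"
  shows "mult le S \<in> S"
proof -
  have "infinite (S - {0})" using S by simp
  then obtain k where k: "k \<in> S" "k \<noteq> 0"
    by (metis DiffE finite.emptyI insertI1 ex_in_conv)
  define B where "B = {x \<in> S - {0}. le x k}"
  have "B \<subseteq> {x \<in> C. le x k}" using S by (auto simp: B_def)
  then have "finite B" using fin k S finite_subset by blast
  have "k \<in> B" using k mo by (auto simp: B_def monomial_order_def reflp_def)
  have "\<exists>x\<in>A. \<forall>y\<in>A. le x y" if "finite A" "A \<noteq> {}" for A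
    using that
  proof (induction A rule: finite_ne_induct)
    case (singleton x)
    then show ?case using mo by (auto simp: monomial_order_def reflp_def)
  next
    case (insert x F)
    then obtain w where w: "w \<in> F" "\<forall>y\<in>F. le w y" by blast
    show ?case
    proof (cases "le w x")
      case True
      then show ?thesis using w by auto
    next
      case False
      then have "le x w"
        using mo unfolding monomial_order_def by (metis reflpD totalpD)
      moreover have "le x x"
        using mo by (auto simp: monomial_order_def reflp_def)
      ultimately show ?thesis
        using w mo unfolding monomial_order_def by (metis insert_iff transpD)
    qed
  qed
  then obtain x where x: "x \<in> B" "\<forall>y\<in>B. le x y"
    using \<open>finite B\<close> \<open>k \<in> B\<close> by blast
  have le: "le x y" if "y \<in> S - {0}" for y
  proof (cases "le y k")
    case True
    then show ?thesis using x that by (auto simp: B_def)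
  next
    case False
    then have "le k y" using mo unfolding monomial_order_def by (metis reflpD totalpD)
    then show ?thesis
      using x mo unfolding B_def monomial_order_def by (metis (no_types, lifting) mem_Collect_eq transpD)
  qed
  have "mult le S = x"
    unfolding mult_def min_wrt_def
    by (rule the_equality) (use x le mo in \<open>auto simp: B_def monomial_order_def antisymp_def\<close>)
  then show ?thesis using x by (auto simp: B_def)
qed

lemma multiples_subset:
  assumes "submonoid S" "m \<in> S"
  shows "multiples m \<subseteq> S"
proof -
  have "k *s m \<in> S" for k
  proof (induction k)
    case 0
    then show ?case using assms by (simp add: submonoid_def)
  next
    case (Suc k)
    have "Suc k *s m = m + k *s m" by (simp add: vec_eq_iff)
    then show ?case using Suc assms by (simp add: submonoid_def)
  qed
  then show ?thesis by (auto simp: multiples_def)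
qed

lemma A_semigroups_degenerate:
  assumes mo: "monomial_order le" and fin: "\<And>k. k \<in> C \<Longrightarrow> finite {x \<in> C. le x k}"
    and "f \<in> multiples m \<or> m \<in> canonical_basis \<and> strict le m f"
  shows "A_semigroups le C f m = {}"
proof (rule ccontr)
  assume "A_semigroups le C f m \<noteq> {}"
  then obtain S where S: "A_semigroup le C S" "Fb le C S = int_vec f" "mult le S = m"
    by (auto simp: A_semigroups_def)
  then have C: "S \<subseteq> C" "infinite S" "submonoid S" "finite (C - S)"
    by (auto simp: A_semigroup_def C_semigroup_def)
  have "m \<in> S" using mult_mem[OF mo fin C(1,2)] S by simp
  have "f \<notin> S" using Fb_notin[OF mo C(4) S(2)] .
  then have "f \<notin> multiples m"
    using multiples_subset[OF C(3) \<open>m \<in> S\<close>] by blast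
  then have m: "m \<in> canonical_basis" "strict le m f"
    using assms by auto
  have "0 \<in> S" using C by (simp add: submonoid_def)
  then have "strict le 0 f"
    using mo \<open>f \<notin> S\<close> by (auto simp: strict_def monomial_order_def)
  moreover have "int_strict le (int_vec x) (int_vec f)" if "strict le x f" for x
    unfolding int_strict_def using that
    by (intro exI[of _ 0] exI[of _ x] exI[of _ f]) (simp add: int_vec_def vec_eq_iff)
  ultimately have "{0, 0 + m} \<subseteq> small_elements le C S"
    using m \<open>0 \<in> S\<close> \<open>m \<in> S\<close> S by (auto simp: small_elements_def)
  then show False
    using S m \<open>0 \<in> S\<close> by (auto simp: A_semigroup_def)
qed

end

theory Submission
  imports Defs
begin

text \<open>The map \<open>S \<mapsto> S - {ratio le S}\<close> is a parent function on \<open>\<A>(f,m)\<close> away from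
  \<open>\<Delta>(f,m)\<close>. Every \<open>S \<in> \<A>(f,m)\<close> contains the multiples of \<open>m\<close> and everything in \<open>C\<close>
  above \<open>f\<close>, hence contains \<open>\<Delta>(f,m)\<close>; if it has a further element, that element lies below
  \<open>f\<close> and is not a multiple of \<open>m\<close>, so the ratio \<open>r\<close> of \<open>S\<close> is below \<open>f\<close> too. A sum of two
  nonzero elements of \<open>S\<close> that equals \<open>r\<close> would have both summands below \<open>r\<close>, hence
  multiples of \<open>m\<close>, and then \<open>r\<close> would be one as well. So \<open>S - {r}\<close> is a monoid, and it
  keeps the Frobenius element and the multiplicity; the condition on
  consecutive small elements is inherited by subsets (\<open>remove_ratio\<close>). Each step removes one
  of the finitely many elements of \<open>S\<close> below \<open>f\<close>, so iterating it ends at \<open>\<Delta>(f,m)\<close>. No edge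
  leaves \<open>\<Delta>(f,m)\<close>, because a vertex cannot be a proper subset of it, and every other
  vertex has exactly one outgoing edge; so the walk to the root is unique
  (\<open>tree_with_root_if_parent\<close>).

  Membership in \<open>\<A>(f,m)\<close> also demands that the monoid be finitely generated and that
  \<open>C\<close> be the least integer cone around it. Both follow from cofiniteness in \<open>C\<close>
  (\<open>C_semigroup_if_cofinite\<close>), which leaves the purely order-theoretic
  description \<open>A_semigroups_iff\<close>. Finite generation is a version of Gordan's lemma. Round
  down the coefficients of the points of \<open>C\<close> over integral generators of the real cone; the
  remainders are bounded integer vectors. Dickson's lemma, applied to all these data at once,
  shows that every sequence in \<open>C\<close> has a subsequence in which later terms differ from
  earlier ones by elements of \<open>C\<close> (\<open>integer_cone_subseq\<close>). A sequence of distinct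
  irreducible elements of a cofinite submonoid contradicts this: infinitely many
  differences from its first term would occur, and one of them would lie in the
  submonoid.\<close>

section \<open>Dickson's lemma\<close>

lemma nat_seq_mono_subseq:
  fixes g :: "nat \<Rightarrow> nat"
  shows "\<exists>r :: nat \<Rightarrow> nat. strict_mono r \<and> (\<forall>i j. i \<le> j \<longrightarrow> g (r i) \<le> g (r j))"
proof -
  obtain r where r: "strict_mono r" "monoseq (\<lambda>n. g (r n))"
    using seq_monosub[of g] by blast
  show ?thesis
  proof (cases "\<forall>i j. i \<le> j \<longrightarrow> g (r i) \<le> g (r j)")
    case True
    then show ?thesis using r(1) by blast
  next
    case False
    then have dec: "g (r j) \<le> g (r i)" if "i \<le> j" for i j
      using r(2) that unfolding monoseq_def by blast
    obtain N where N: "\<forall>n. g (r N) \<le> g (r n)"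
      using ex_has_least_nat[of "\<lambda>_. True" 0 "\<lambda>n. g (r n)"] by auto
    have const: "g (r (N + n)) = g (r N)" for n
      using dec[of N "N + n"] N[rule_format, of "N + n"] by (intro order_antisym) auto
    have "strict_mono (\<lambda>n. r (N + n))"
      using r(1) unfolding strict_mono_def by simp
    then show ?thesis
      by (intro exI[of _ "\<lambda>n. r (N + n)"]) (simp add: const)
  qed
qed

text \<open>Dickson's lemma with the coordinates given by an arbitrary finite family \<open>F\<close> of functions, so
  that it can be applied to derived data of the points and not only to their components.\<close>

lemma dickson_subseq:
  fixes s :: "nat \<Rightarrow> 'a" and F :: "('a \<Rightarrow> nat) set"
  assumes "finite F"
  shows "\<exists>r :: nat \<Rightarrow> nat. strict_mono r \<and> (\<forall>\<phi>\<in>F. \<forall>i j. i \<le> j \<longrightarrow> \<phi> (s (r i)) \<le> \<phi> (s (r j)))"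
  using assms
proof (induction F rule: finite_induct)
  case empty
  then show ?case by (intro exI[of _ id]) (simp add: strict_mono_def)
next
  case (insert \<phi> F)
  then obtain r :: "nat \<Rightarrow> nat" where r: "strict_mono r"
    and mono: "\<forall>\<psi>\<in>F. \<forall>i j. i \<le> j \<longrightarrow> \<psi> (s (r i)) \<le> \<psi> (s (r j))"
    by blast
  obtain q :: "nat \<Rightarrow> nat" where q: "strict_mono q"
    "\<forall>i j. i \<le> j \<longrightarrow> \<phi> (s (r (q i))) \<le> \<phi> (s (r (q j)))"
    using nat_seq_mono_subseq[of "\<lambda>n. \<phi> (s (r n))"] by blast
  have "strict_mono (\<lambda>n. r (q n))" using r q(1) by (simp add: strict_mono_def)
  moreover have "q i \<le> q j" if "i \<le> j" for i j
    using q(1) that by (simp add: strict_mono_less_eq)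
  ultimately show ?case
    using q(2) by (intro exI[of _ "\<lambda>n. r (q n)"]) (simp add: mono)
qed

section \<open>Integer cones\<close>

lemma real_vec_add: "real_vec (x + y) = real_vec x + real_vec y"
  by (simp add: real_vec_def vec_eq_iff)

lemma real_vec_smult: "real_vec (k *s x) = real k *\<^sub>R real_vec x"
  by (simp add: real_vec_def vec_eq_iff)

lemma submonoid_integer_cone:
  assumes "integer_cone C"
  shows "submonoid C"
proof -
  obtain V :: "(real ^ 'a) set" where C: "C = {x. real_vec x \<in> convex_cone hull V}"
    using assms by (auto simp: integer_cone_def)
  have "real_vec 0 = (0 :: real ^ 'a)" by (simp add: real_vec_def vec_eq_iff)
  then show ?thesis
    by (auto simp: C submonoid_def real_vec_add convex_cone_hull_add convex_cone_hull_contains_0)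
qed

text \<open>Integer cones are saturated, which makes \<open>C\<close> the least integer cone around any of its cofinite
  submonoids: some positive multiple of each point of \<open>C\<close> lies in the submonoid.\<close>

lemma integer_cone_divide:
  assumes "integer_cone D" "k *s x \<in> D" "k > 0"
  shows "x \<in> D"
proof -
  obtain V :: "(real ^ 'a) set" where D: "D = {x. real_vec x \<in> convex_cone hull V}"
    using assms(1) by (auto simp: integer_cone_def)
  have "(1 / real k) *\<^sub>R real_vec (k *s x) \<in> convex_cone hull V"
    using assms(2) by (intro convex_cone_hull_mul) (auto simp: D)
  then show ?thesis using assms(3) by (simp add: D real_vec_smult)
qed

lemma sum_in_convex_cone_hull:
  assumes "finite V" "\<And>v. v \<in> V \<Longrightarrow> 0 \<le> c v"
  shows "(\<Sum>v\<in>V. c v *\<^sub>R v) \<in> convex_cone hull V"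
proof -
  have "(\<Sum>v\<in>W. c v *\<^sub>R v) \<in> convex_cone hull V" if "finite W" "W \<subseteq> V" for W
    using that
    by (induction W rule: finite_induct)
      (auto intro: convex_cone_hull_add convex_cone_hull_mul hull_inc assms(2)
        simp: convex_cone_hull_contains_0)
  then show ?thesis using assms(1) by simp
qed

text \<open>The nonnegative combinations of \<open>V\<close> already form a convex cone containing \<open>V\<close>.\<close>

lemma convex_cone_hull_coefficients:
  assumes "finite V" "x \<in> convex_cone hull V"
  shows "\<exists>c. (\<forall>v. 0 \<le> c v) \<and> x = (\<Sum>v\<in>V. c v *\<^sub>R v)"
proof -
  define K where "K = {\<Sum>v\<in>V. c v *\<^sub>R v | c. \<forall>v. 0 \<le> c v}"
  have "convex_cone K"
    unfolding convex_cone_iff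
  proof (intro conjI ballI allI impI)
    show "0 \<in> K" by (auto simp: K_def intro!: exI[of _ "\<lambda>_. 0"])
    fix x y assume "x \<in> K" "y \<in> K"
    then obtain c d where "\<forall>v. 0 \<le> c v" "\<forall>v. 0 \<le> d v"
      "x = (\<Sum>v\<in>V. c v *\<^sub>R v)" "y = (\<Sum>v\<in>V. d v *\<^sub>R v)"
      by (auto simp: K_def)
    then show "x + y \<in> K"
      by (auto simp: K_def sum.distrib scaleR_add_left intro!: exI[of _ "\<lambda>v. c v + d v"])
  next
    fix x and a :: real assume "x \<in> K" "0 \<le> a"
    then obtain c where "\<forall>v. 0 \<le> c v" "x = (\<Sum>v\<in>V. c v *\<^sub>R v)"
      by (auto simp: K_def)
    then show "a *\<^sub>R x \<in> K"
      using \<open>0 \<le> a\<close> by (auto simp: K_def scaleR_sum_right intro!: exI[of _ "\<lambda>v. a * c v"])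
  qed
  moreover have "V \<subseteq> K"
  proof
    fix v assume "v \<in> V"
    then have "(\<Sum>w\<in>V. (if w = v then 1 else 0) *\<^sub>R w) = v"
      using assms(1) by (simp add: if_distrib[of "\<lambda>a. a *\<^sub>R _"] cong: if_cong)
    then show "v \<in> K"
      unfolding K_def by (intro CollectI exI[of _ "\<lambda>w. if w = v then 1 else 0"]) auto
  qed
  ultimately have "x \<in> K" using assms(2) hull_minimal[of V K convex_cone] by blast
  then show ?thesis unfolding K_def by blast
qed

lemma common_denominator:
  assumes "finite Q" "Q \<subseteq> \<rat>"
  shows "\<exists>N>0. \<forall>q\<in>Q. real N * q \<in> \<int>"
  using assms
proof (induction Q rule: finite_induct)
  case empty
  then show ?case by auto
next
  case (insert q Q)
  then obtain N where N: "N > 0" "\<forall>q\<in>Q. real N * q \<in> \<int>" by auto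
  obtain a b where ab: "b > 0" "q = of_int a / of_int b"
    using insert.prems Rats_cases'[of q] by (metis insert_subset)
  have "real (N * nat b) * p \<in> \<int>" if "p \<in> insert q Q" for p
  proof (cases "p = q")
    case True
    then have "real (N * nat b) * p = of_int (int N * a)" using ab by simp
    then show ?thesis by (simp only: Ints_of_int)
  next
    case False
    then have "real N * p \<in> \<int>" using N that by auto
    then have "of_int b * (real N * p) \<in> \<int>" by (rule Ints_mult[OF Ints_of_int])
    moreover have "of_int b * (real N * p) = real (N * nat b) * p" using ab by simp
    ultimately show ?thesis by simp
  qed
  then show ?case using N ab by (intro exI[of _ "N * nat b"]) auto
qed

text \<open>Translates bounded integers to natural numbers, to which Dickson's lemma applies.\<close>

lemma nat_floor_shift_le_iff:
  fixes a b :: real and K :: int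
  assumes "a \<in> \<int>" "b \<in> \<int>" "- of_int K \<le> a" "- of_int K \<le> b"
  shows "nat \<lfloor>of_int K + a\<rfloor> \<le> nat \<lfloor>of_int K + b\<rfloor> \<longleftrightarrow> a \<le> b"
  using assms by (elim Ints_cases) auto

text \<open>After scaling by a common denominator \<open>N\<close> the generators of the cone are integral. A point
  \<open>x\<close> of \<open>C\<close> is then the sum of a natural combination of them, with coefficients \<open>n x v\<close>, and a
  remainder \<open>y x\<close>, which is a bounded integer vector. If two points have the same remainder and
  their coefficients are ordered, then their difference is again in the real
  cone; it is a point of \<open>C\<close> once the coordinates are ordered too.\<close>

lemma integer_cone_subseq:
  fixes C :: "(nat ^ 'p) set"
  assumes "integer_cone C" and s: "\<And>n. s n \<in> C"
  shows "\<exists>r :: nat \<Rightarrow> nat. strict_mono r \<and> (\<forall>i j. i \<le> j \<longrightarrow> (\<exists>z\<in>C. s (r j) = s (r i) + z))"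
proof -
  obtain V :: "(real ^ 'p) set" where V: "finite V" "\<And>v i. v \<in> V \<Longrightarrow> v $ i \<in> \<rat>"
    and C: "C = {x. real_vec x \<in> convex_cone hull V}"
    using assms(1) by (auto simp: integer_cone_def)
  obtain N where N: "N > 0" "\<And>v i. v \<in> V \<Longrightarrow> real N * v $ i \<in> \<int>"
    using common_denominator[of "(\<lambda>(v, i). v $ i) ` (V \<times> UNIV)"] V by fastforce
  have "\<exists>d. (\<forall>v. 0 \<le> d v) \<and> real_vec x = (\<Sum>v\<in>V. (d v * real N) *\<^sub>R v)" if x: "x \<in> C" for x
  proof -
    obtain c where c: "\<forall>v. 0 \<le> c v" "real_vec x = (\<Sum>v\<in>V. c v *\<^sub>R v)"
      using convex_cone_hull_coefficients[OF V(1), of "real_vec x"] x unfolding C by blast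
    then show ?thesis using N(1) by (intro exI[of _ "\<lambda>v. c v / real N"]) simp
  qed
  then obtain d where d: "\<And>x v. x \<in> C \<Longrightarrow> 0 \<le> d x v"
    "\<And>x. x \<in> C \<Longrightarrow> real_vec x = (\<Sum>v\<in>V. (d x v * real N) *\<^sub>R v)"
    by metis
  define n where "n x v = nat \<lfloor>d x v\<rfloor>" for x v
  define y where "y x i = real (x $ i) - (\<Sum>v\<in>V. real (n x v) * (real N * v $ i))" for x :: "nat ^ 'p" and i
  define K where "K i = \<lceil>\<Sum>v\<in>V. \<bar>real N * v $ i\<bar>\<rceil>" for i
  have y_int: "y x i \<in> \<int>" for x i
    unfolding y_def by (intro Ints_diff Ints_sum Ints_mult[OF _ N(2)]) auto
  have y_bound: "\<bar>y x i\<bar> \<le> of_int (K i)" if "x \<in> C" for x i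
  proof -
    have "real (x $ i) = (\<Sum>v\<in>V. d x v * (real N * v $ i))"
      using d(2)[OF that] by (simp add: real_vec_def vec_eq_iff mult.assoc)
    then have "y x i = (\<Sum>v\<in>V. (d x v - real (n x v)) * (real N * v $ i))"
      by (simp add: y_def sum_subtractf left_diff_distrib)
    also have "\<bar>\<dots>\<bar> \<le> (\<Sum>v\<in>V. \<bar>real N * v $ i\<bar>)"
    proof (rule order_trans[OF sum_abs sum_mono])
      fix v
      have "0 \<le> d x v" using d(1)[OF that] .
      then have "\<bar>d x v - real (n x v)\<bar> \<le> 1" unfolding n_def by linarith
      then show "\<bar>(d x v - real (n x v)) * (real N * v $ i)\<bar> \<le> \<bar>real N * v $ i\<bar>"
        unfolding abs_mult[of "d x v - real (n x v)"] by (intro mult_left_le_one_le) auto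
    qed
    also have "\<dots> \<le> of_int (K i)" by (simp add: K_def)
    finally show ?thesis .
  qed
  (* Monotonicity of both K + y and K - y forces the remainder to be constant. *)
  define F where "F = range (\<lambda>i x. x $ i) \<union> (\<lambda>v x. n x v) ` V \<union>
    range (\<lambda>i x. nat \<lfloor>of_int (K i) + y x i\<rfloor>) \<union> range (\<lambda>i x. nat \<lfloor>of_int (K i) + (- y x i)\<rfloor>)"
  have "finite F" using V(1) by (simp add: F_def)
  then obtain r :: "nat \<Rightarrow> nat" where r: "strict_mono r"
    and mono: "\<forall>\<phi>\<in>F. \<forall>i j. i \<le> j \<longrightarrow> \<phi> (s (r i)) \<le> \<phi> (s (r j))"
    using dickson_subseq[of F s] by blast
  have "\<exists>z\<in>C. s (r j) = s (r i) + z" if "i \<le> j" for i j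
  proof -
    define a b where "a = s (r i)" and "b = s (r j)"
    have "a \<in> C" "b \<in> C" using s by (auto simp: a_def b_def)
    have ab: "\<phi> a \<le> \<phi> b" if "\<phi> \<in> F" for \<phi>
      using mono that \<open>i \<le> j\<close> by (simp add: a_def b_def)
    have coord: "a $ k \<le> b $ k" for k
      using ab[of "\<lambda>x. x $ k"] by (auto simp: F_def)
    have coeff: "n a v \<le> n b v" if "v \<in> V" for v
      using ab[of "\<lambda>x. n x v"] that by (auto simp: F_def)
    have y_eq: "y a k = y b k" for k
    proof -
      have "- of_int (K k) \<le> y x k" "- of_int (K k) \<le> - y x k" if "x \<in> C" for x
        using y_bound[OF that, of k] by linarith+
      moreover have "nat \<lfloor>of_int (K k) + y a k\<rfloor> \<le> nat \<lfloor>of_int (K k) + y b k\<rfloor>"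
        using ab[of "\<lambda>x. nat \<lfloor>of_int (K k) + y x k\<rfloor>"] by (auto simp: F_def)
      moreover have "nat \<lfloor>of_int (K k) + (- y a k)\<rfloor> \<le> nat \<lfloor>of_int (K k) + (- y b k)\<rfloor>"
        using ab[of "\<lambda>x. nat \<lfloor>of_int (K k) + (- y x k)\<rfloor>"] unfolding F_def by blast
      ultimately show ?thesis
        using y_int \<open>a \<in> C\<close> \<open>b \<in> C\<close>
        by (metis Ints_minus nat_floor_shift_le_iff neg_le_iff_le order_antisym)
    qed
    have "real (b $ k) - real (a $ k) =
        (\<Sum>v\<in>V. (real (n b v) - real (n a v)) * (real N * v $ k))" for k
      using y_eq[of k] unfolding y_def left_diff_distrib sum_subtractf by linarith
    then have "real_vec (b - a) = (\<Sum>v\<in>V. ((real (n b v) - real (n a v)) * real N) *\<^sub>R v)"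
      using coord by (simp add: real_vec_def vec_eq_iff of_nat_diff mult.assoc)
    also have "\<dots> \<in> convex_cone hull V"
      using V(1) coeff by (intro sum_in_convex_cone_hull) auto
    finally have "b - a \<in> C" by (simp add: C)
    moreover have "b = a + (b - a)" using coord by (simp add: vec_eq_iff)
    ultimately show "\<exists>z\<in>C. s (r j) = s (r i) + z" unfolding a_def b_def by blast
  qed
  then show ?thesis using r by blast
qed

section \<open>Submonoids with finite complement in a cone\<close>

lemma submonoid_hull: "submonoid (submonoid hull G)"
  by (auto simp: submonoid_def hull_def)

text \<open>The irreducible elements generate, by induction on the sum of the coordinates. They are
  finite in number: from a sequence of distinct ones, infinitely many
  differences \<open>z j\<close> with one fixed term would lie in \<open>C\<close>, only finitely many of them outside \<open>T\<close>,
  and a nonzero difference in \<open>T\<close> decomposes an irreducible element.\<close>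

lemma finitely_generated_if_cofinite:
  fixes C T :: "(nat ^ 'p) set"
  assumes C: "integer_cone C" and T: "submonoid T" "T \<subseteq> C" and fin: "finite (C - T)"
  shows "\<exists>G. finite G \<and> T = submonoid hull G"
proof -
  define G where "G = {x \<in> T - {0}. \<nexists>a b. a \<in> T - {0} \<and> b \<in> T - {0} \<and> x = a + b}"
  have "finite G"
  proof (rule ccontr)
    assume "infinite G"
    then obtain s :: "nat \<Rightarrow> nat ^ 'p" where s: "inj s" "range s \<subseteq> G"
      using infinite_countable_subset by blast
    then have "s n \<in> C" for n using T by (auto simp: G_def)
    then obtain r :: "nat \<Rightarrow> nat" where r: "strict_mono r" and "\<forall>i j. i \<le> j \<longrightarrow> (\<exists>z\<in>C. s (r j) = s (r i) + z)"
      using integer_cone_subseq[OF C, of s] by blast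
    then have "\<exists>z\<in>C. s (r j) = s (r 0) + z" for j by blast
    then obtain z where z: "\<And>j. z j \<in> C" "\<And>j. s (r j) = s (r 0) + z j" by metis
    have sr: "s (r i) = s (r j) \<longleftrightarrow> i = j" for i j
      using s(1) r by (simp add: inj_eq strict_mono_eq)
    then have "inj z" using z(2) by (metis injI)
    then have "finite {j. z j \<in> insert 0 (C - T)}"
      using finite_vimageI[of "insert 0 (C - T)" z] fin by (simp add: vimage_def)
    then obtain j where "z j \<notin> insert 0 (C - T)"
      by (metis (mono_tags, lifting) ex_new_if_finite infinite_UNIV_nat mem_Collect_eq)
    then have "z j \<in> T - {0}" using z(1) by auto
    moreover have "s (r 0) \<in> T - {0}" "s (r j) \<in> G" using s(2) by (auto simp: G_def)
    ultimately show False using z(2)[of j] unfolding G_def by blast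
  qed
  moreover have "submonoid hull G \<subseteq> T"
    using T(1) by (intro hull_minimal) (auto simp: G_def)
  moreover have "x \<in> submonoid hull G" if "x \<in> T" for x
    using that
  proof (induction "\<Sum>i\<in>UNIV. x $ i" arbitrary: x rule: less_induct)
    case less
    consider "x = 0" | "x \<in> G" | a b where "a \<in> T - {0}" "b \<in> T - {0}" "x = a + b"
      using less.prems by (auto simp: G_def)
    then show ?case
    proof cases
      case 1
      then show ?thesis using submonoid_hull by (auto simp: submonoid_def)
    next
      case 2
      then show ?thesis by (rule hull_inc)
    next
      case 3
      have pos: "0 < (\<Sum>i\<in>UNIV. c $ i)" if "c \<noteq> 0" for c :: "nat ^ 'p"
        using that by (auto simp: vec_eq_iff intro!: sum_pos2 gr0I)
      have "(\<Sum>i\<in>UNIV. x $ i) = (\<Sum>i\<in>UNIV. a $ i) + (\<Sum>i\<in>UNIV. b $ i)"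
        by (simp add: 3 sum.distrib)
      then have "a \<in> submonoid hull G" "b \<in> submonoid hull G"
        using 3 pos[of a] pos[of b] less.hyps by auto
      then show ?thesis using submonoid_hull 3 by (auto simp: submonoid_def)
    qed
  qed
  ultimately show ?thesis by blast
qed

lemma smult_in_multiples: "k *s m \<in> multiples m"
  by (simp add: multiples_def)

lemma zero_in_multiples: "0 \<in> multiples m"
  using smult_in_multiples[of 0 m] by simp

lemma self_in_multiples: "m \<in> multiples m"
  using smult_in_multiples[of 1 m] by (simp only: vector_smult_lid)

lemma multiples_add:
  assumes "x \<in> multiples m" "y \<in> multiples m"
  shows "x + y \<in> multiples m"
proof -
  obtain a b where "x = a *s m" "y = b *s m" using assms unfolding multiples_def by blast
  then have "x + y = (a + b) *s m" by (simp add: vec_eq_iff add_mult_distrib)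
  then show ?thesis by (simp only: smult_in_multiples)
qed

lemma infinite_multiples:
  fixes x :: "nat ^ 'p"
  assumes "x \<noteq> 0"
  shows "inj (\<lambda>k. k *s x)" "infinite (multiples x)"
proof -
  show "inj (\<lambda>k. k *s x)" using assms by (auto simp: inj_def vec_eq_iff)
  then show "infinite (multiples x)"
    unfolding multiples_def using finite_imageD infinite_UNIV_nat by blast
qed

text \<open>The algebraic and geometric requirements on a \<open>C\<close>-semigroup all follow from
  cofiniteness.\<close>

lemma C_semigroup_if_cofinite:
  fixes C T :: "(nat ^ 'p) set"
  assumes C: "integer_cone C" and T: "submonoid T" "T \<subseteq> C" and fin: "finite (C - T)"
    and m: "m \<in> T" "m \<noteq> 0"
  shows "C_semigroup C T"
proof -
  have "infinite T"
    using infinite_multiples(2)[OF m(2)] multiples_subset[OF T(1) m(1)] finite_subset by blast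
  moreover have "x \<in> D" if D: "integer_cone D" "T \<subseteq> D" and x: "x \<in> C" for D x
  proof (cases "x = 0")
    case True
    then show ?thesis using T(1) D(2) by (auto simp: submonoid_def)
  next
    case False
    have "finite {k. k *s x \<in> insert 0 (C - T)}"
      using finite_vimageI[OF _ infinite_multiples(1)[OF False], of "insert 0 (C - T)"] fin
      by (simp add: vimage_def)
    then obtain k where k: "k *s x \<notin> insert 0 (C - T)"
      by (metis (mono_tags, lifting) ex_new_if_finite infinite_UNIV_nat mem_Collect_eq)
    then have "k > 0" by (intro gr0I) auto
    moreover have "k *s x \<in> C"
      using multiples_subset[OF submonoid_integer_cone[OF C] x] by (auto simp: multiples_def)
    ultimately show ?thesis using integer_cone_divide D k by blast
  qed
  ultimately show ?thesis
    unfolding C_semigroup_def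
    using assms finitely_generated_if_cofinite[OF C T fin] by blast
qed

section \<open>Monomial orders on a cone\<close>

locale cone_order =
  fixes C :: "(nat ^ 'p) set" and le :: "nat ^ 'p \<Rightarrow> nat ^ 'p \<Rightarrow> bool"
  assumes cone: "integer_cone C"
    and monomial: "monomial_order le"
    and finite_below: "\<And>k. k \<in> C \<Longrightarrow> finite {x \<in> C. le x k}"
begin

abbreviation less where "less x y \<equiv> strict le x y"

lemma le_refl: "le x x"
  using monomial by (auto simp: monomial_order_def reflp_def)

lemma le_antisym: "le x y \<Longrightarrow> le y x \<Longrightarrow> x = y"
  using monomial by (auto simp: monomial_order_def antisymp_def)

lemma le_trans: "le x y \<Longrightarrow> le y z \<Longrightarrow> le x z"
  using monomial unfolding monomial_order_def by (metis transpD)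

lemma le_total: "le x y \<or> le y x"
  using monomial le_refl unfolding monomial_order_def by (metis totalpD)

lemma not_less_iff: "\<not> less x y \<longleftrightarrow> le y x"
  using monomial le_antisym le_refl unfolding monomial_order_def strict_def by (metis totalpD)

lemma less_le_trans: "less x y \<Longrightarrow> le y z \<Longrightarrow> less x z"
  using le_trans le_antisym unfolding strict_def by metis

lemma le_less_trans: "le x y \<Longrightarrow> less y z \<Longrightarrow> less x z"
  using le_trans le_antisym unfolding strict_def by metis

lemma le_add_left_mono: "le x y \<Longrightarrow> le (x + z) (y + z)"
  using monomial by (auto simp: monomial_order_def)

lemma zero_le: "le 0 x"
  using monomial by (auto simp: monomial_order_def)

lemma le_add_self: "le x (y + x)"
  using le_add_left_mono[OF zero_le[of y], of x] by simp

text \<open>Cancellation holds for a monomial order because the order is total, so its extension to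
  \<open>\<int>\<^sup>p\<close> does not relate any new pairs of points of \<open>\<nat>\<^sup>p\<close>.\<close>

lemma int_strict_iff: "int_strict le (int_vec x) (int_vec y) \<longleftrightarrow> less x y"
proof
  assume "less x y"
  then show "int_strict le (int_vec x) (int_vec y)"
    unfolding int_strict_def
    by (intro exI[of _ 0] exI[of _ x] exI[of _ y]) (simp add: int_vec_def vec_eq_iff)
next
  assume "int_strict le (int_vec x) (int_vec y)"
  then obtain c u v where "int_vec x + int_vec c = int_vec u" "int_vec y + int_vec c = int_vec v"
    and uv: "less u v"
    by (auto simp: int_strict_def)
  moreover have "int_vec a + int_vec b = int_vec (a + b)" for a b :: "nat ^ 'p"
    by (simp add: int_vec_def vec_eq_iff)
  ultimately have "u = x + c" "v = y + c" by (simp_all add: int_vec_inj)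
  then show "less x y"
    using uv le_add_left_mono[of y x c] by (metis not_less_iff)
qed

lemma min_wrt_eq: "x \<in> A \<Longrightarrow> (\<And>y. y \<in> A \<Longrightarrow> le x y) \<Longrightarrow> min_wrt le A = x"
  unfolding min_wrt_def by (intro the_equality) (auto intro: le_antisym)

lemma max_wrt_eq: "x \<in> A \<Longrightarrow> (\<And>y. y \<in> A \<Longrightarrow> le y x) \<Longrightarrow> max_wrt le A = x"
  unfolding max_wrt_def by (intro the_equality) (auto intro: le_antisym)

lemma transp_totalp: "transp_on A le" "totalp_on A le"
  using le_trans monomial
  by (auto simp: transp_on_def totalp_on_def monomial_order_def)

lemma max_wrt:
  assumes "finite A" "A \<noteq> {}"
  shows "max_wrt le A \<in> A" "\<And>y. y \<in> A \<Longrightarrow> le y (max_wrt le A)"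
proof -
  obtain x where x: "x \<in> A" "\<And>y. y \<in> A \<Longrightarrow> le y x"
    using Finite_Set.bex_greatest_element[OF assms transp_totalp(1,2)] le_refl by metis
  then show "max_wrt le A \<in> A" "\<And>y. y \<in> A \<Longrightarrow> le y (max_wrt le A)"
    using max_wrt_eq[OF x] by auto
qed

text \<open>A minimum may be sought among the finitely many elements up to any given one.\<close>

lemma min_wrt:
  assumes "A \<subseteq> C" "A \<noteq> {}"
  shows "min_wrt le A \<in> A" "\<And>y. y \<in> A \<Longrightarrow> le (min_wrt le A) y"
proof -
  obtain k where k: "k \<in> A" using assms by blast
  define B where "B = {x \<in> A. le x k}"
  have "finite B"
    using finite_subset[of B "{x \<in> C. le x k}"] finite_below k assms(1) by (auto simp: B_def)
  moreover have "k \<in> B" using k le_refl by (simp add: B_def)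
  ultimately have "\<exists>x\<in>B. \<forall>y\<in>B. y \<noteq> x \<longrightarrow> le x y"
    using Finite_Set.bex_least_element[OF _ _ transp_totalp(1,2), of B] by blast
  then have "\<exists>x\<in>B. \<forall>y\<in>B. le x y"
    using le_refl by metis
  then obtain x where x: "x \<in> B" "\<forall>y\<in>B. le x y"
    by blast
  have "le x y" if "y \<in> A" for y
  proof (cases "le y k")
    case True
    then show ?thesis using x(2) that by (simp add: B_def)
  next
    case False
    then have "le k y" using le_total by blast
    then show ?thesis using x(1) le_trans[of x k y] by (simp add: B_def)
  qed
  moreover have "x \<in> A" using x by (simp add: B_def)
  ultimately show "min_wrt le A \<in> A" "\<And>y. y \<in> A \<Longrightarrow> le (min_wrt le A) y"
    using min_wrt_eq[of x A] by auto
qed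

section \<open>The semigroups with given Frobenius element and multiplicity\<close>

text \<open>The conventional value for \<open>C - S = {}\<close> has negative coordinates, so it never equals
  \<open>int_vec f\<close>.\<close>

lemma Fb_eq_iff:
  assumes "finite (C - S)"
  shows "Fb le C S = int_vec f \<longleftrightarrow> f \<in> C - S \<and> {x \<in> C. less f x} \<subseteq> S"
proof
  assume "Fb le C S = int_vec f"
  moreover have "- (\<Sum>i\<in>UNIV. axis i 1) \<noteq> int_vec f"
  proof
    assume "- (\<Sum>i\<in>UNIV. axis i 1) = int_vec f"
    then have "(- (\<Sum>i\<in>UNIV. axis i (1::int))) $ j = int_vec f $ j" for j
      by simp
    moreover have "(- (\<Sum>i\<in>UNIV. axis i (1::int))) $ j = - 1" for j :: 'p
      by (simp add: axis_def)
    ultimately show False by (simp add: int_vec_def)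
  qed
  ultimately have "C - S \<noteq> {}" "max_wrt le (C - S) = f"
    by (auto simp: Fb_def int_vec_inj split: if_splits)
  then show "f \<in> C - S \<and> {x \<in> C. less f x} \<subseteq> S"
    using max_wrt[OF assms] not_less_iff by blast
next
  assume f: "f \<in> C - S \<and> {x \<in> C. less f x} \<subseteq> S"
  then have "max_wrt le (C - S) = f"
    using not_less_iff by (intro max_wrt_eq) blast+
  then show "Fb le C S = int_vec f" using f by (auto simp: Fb_def)
qed

text \<open>Finiteness of \<open>C - S\<close> is implied by the right-hand side, since \<open>C - S\<close> has no element above
  \<open>f\<close> and only finitely many points of \<open>C\<close> lie below \<open>f\<close>. What remains are conditions that can
  be checked elementwise.\<close>

lemma A_semigroups_iff:
  "S \<in> A_semigroups le C f m \<longleftrightarrow>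
     submonoid S \<and> S \<subseteq> C \<and> f \<in> C - S \<and> {x \<in> C. less f x} \<subseteq> S \<and>
     m \<in> S - {0} \<and> (\<forall>x\<in>S - {0}. le m x) \<and>
     (\<forall>s\<in>S. \<forall>e\<in>canonical_basis. s + e \<in> S \<and> less s f \<longrightarrow> \<not> less (s + e) f)"
  (is "?L \<longleftrightarrow> ?R")
proof
  assume ?L
  then have S: "submonoid S" "S \<subseteq> C" "finite (C - S)" "infinite S"
    and Fb: "Fb le C S = int_vec f" and m: "min_wrt le (S - {0}) = m"
    and A: "\<And>s e. s \<in> S \<Longrightarrow> e \<in> canonical_basis \<Longrightarrow> \<not> {s, s + e} \<subseteq> small_elements le C S"
    by (auto simp: A_semigroups_def A_semigroup_def C_semigroup_def mult_def)
  have "small_elements le C S = {x \<in> S. less x f}"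
    by (simp add: small_elements_def Fb int_strict_iff)
  then have "\<forall>s\<in>S. \<forall>e\<in>canonical_basis. s + e \<in> S \<and> less s f \<longrightarrow> \<not> less (s + e) f"
    using A by auto
  moreover have "f \<in> C - S \<and> {x \<in> C. less f x} \<subseteq> S"
    using Fb_eq_iff[OF S(3), of f] Fb by simp
  moreover have "S - {0} \<noteq> {}"
    using S(4) by (metis finite.emptyI infinite_remove)
  then have "m \<in> S - {0}" "\<forall>x\<in>S - {0}. le m x"
    using min_wrt[of "S - {0}"] S(2) m by auto
  ultimately show ?R
    using S(1,2) by blast
next
  assume R: ?R
  have "C - S \<subseteq> {x \<in> C. le x f}" using R not_less_iff by blast
  then have fin: "finite (C - S)" using finite_below R finite_subset by blast
  then have Fb: "Fb le C S = int_vec f" using Fb_eq_iff[of S f] R by blast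
  then have "small_elements le C S = {x \<in> S. less x f}"
    by (simp add: small_elements_def int_strict_iff)
  moreover have "C_semigroup C S"
    using C_semigroup_if_cofinite[OF cone _ _ fin, of m] R by blast
  moreover have "mult le S = m"
    unfolding mult_def using R by (intro min_wrt_eq) auto
  ultimately show ?L
    using R Fb by (auto simp: A_semigroups_def A_semigroup_def)
qed

lemma Delta2_subset:
  assumes "S \<in> A_semigroups le C f m"
  shows "Delta2 le C f m \<subseteq> S"
proof -
  have S: "submonoid S" "m \<in> S" "{x \<in> C. less f x} \<subseteq> S"
    using assms unfolding A_semigroups_iff by blast+
  then have "multiples m \<subseteq> S" "0 \<in> S"
    using multiples_subset by (blast, simp add: submonoid_def)
  then show ?thesis using S(3) by (auto simp: Delta2_def Delta_def)
qed

lemma le_multiples: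
  assumes "x \<in> multiples m" "x \<noteq> 0"
  shows "le m x"
proof -
  obtain k where k: "x = k *s m" using assms(1) unfolding multiples_def by blast
  then have "k \<noteq> 0" using assms(2) by (intro notI) simp
  then obtain j where "k = Suc j" using not0_implies_Suc by blast
  then have "x = j *s m + m" unfolding k by (simp add: vec_eq_iff)
  then show ?thesis using le_add_self[of m "j *s m"] by simp
qed

text \<open>The only way to violate the condition on consecutive small elements is to have two
  multiples of \<open>m\<close> that differ by a basis vector \<open>e\<close>; then \<open>m = e\<close>, and \<open>m\<close> is below \<open>f\<close>.\<close>

lemma Delta2_in_A_semigroups:
  assumes f: "f \<in> C" "f \<notin> multiples m" and m: "m \<in> M_set le C f"
    and basis: "less m f \<Longrightarrow> m \<notin> canonical_basis"
  shows "Delta2 le C f m \<in> A_semigroups le C f m"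
proof -
  let ?D = "Delta2 le C f m"
  have D: "?D = multiples m \<union> {x \<in> C. less f x}"
    using zero_in_multiples by (auto simp: Delta2_def Delta_def)
  have mC: "m \<in> C" "m \<noteq> 0" using m by (auto simp: M_set_def)
  have C: "submonoid C" using cone by (rule submonoid_integer_cone)
  have sub: "?D \<subseteq> C" using multiples_subset[OF C mC(1)] by (auto simp: D)
  have "x + y \<in> ?D" if xy: "x \<in> ?D" "y \<in> ?D" for x y
  proof (cases "less f x \<or> less f y")
    case True
    then have "less f (x + y)"
      using less_le_trans le_add_self[of x y] le_add_self[of y x] by (metis add.commute)
    then show ?thesis using sub xy C by (auto simp: D submonoid_def)
  next
    case False
    then show ?thesis using xy multiples_add by (auto simp: D)
  qed
  then have "submonoid ?D" using zero_in_multiples by (auto simp: submonoid_def D)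
  moreover have "m \<in> multiples m" by (rule self_in_multiples)
  moreover have "le m x" if "x \<in> ?D - {0}" for x
  proof (cases "x \<in> multiples m")
    case True
    then show ?thesis using le_multiples that by auto
  next
    case False
    then have x: "x \<in> C" "less f x" using that by (auto simp: D)
    have "less m f \<or> \<not> less x m" using m x by (auto simp: M_set_def)
    then show ?thesis
      using x(2) less_le_trans[of m f x] not_less_iff[of x m] unfolding strict_def by blast
  qed
  moreover have "\<not> less (s + e) f"
    if se: "s \<in> ?D" "e \<in> canonical_basis" "s + e \<in> ?D" "less s f" for s e
  proof
    assume below: "less (s + e) f"
    have "\<not> less f s" "\<not> less f (s + e)"
      using se(4) below le_antisym unfolding strict_def by blast+
    then obtain a b where ab: "s = a *s m" "s + e = b *s m"
      using se(1,3) unfolding D multiples_def by blast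
    obtain i where i: "e = axis i 1" using se(2) by (auto simp: canonical_basis_def)
    have coord: "a * m $ j + e $ j = b * m $ j" for j
      using ab by (metis vector_add_component vector_smult_component)
    have "a * m $ i + 1 = b * m $ i" using coord[of i] by (simp add: i)
    then have "(b - a) * m $ i = 1" by (simp add: diff_mult_distrib)
    then have "b - a = 1" by simp
    then have "b = Suc a" by arith
    then have "m = e" using coord by (simp add: vec_eq_iff)
    moreover have "less m f"
      using le_add_self[of e s] below \<open>m = e\<close> le_less_trans by auto
    ultimately show False using basis se(2) \<open>m = e\<close> by blast
  qed
  moreover have "f \<in> C - ?D" "{x \<in> C. less f x} \<subseteq> ?D" "multiples m \<subseteq> ?D"
    using f by (auto simp: D strict_def)
  ultimately show ?thesis
    using sub mC(2) unfolding A_semigroups_iff by blast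
qed

text \<open>The ratio is below \<open>f\<close> because \<open>S\<close> has an element below \<open>f\<close> that is not a multiple of \<open>m\<close>;
  hence it can be removed without changing the Frobenius element. It is irreducible
  because everything below it in \<open>S\<close> is a multiple of \<open>m\<close>.\<close>

lemma remove_ratio:
  assumes S: "S \<in> A_semigroups le C f m" and ne: "S \<noteq> Delta2 le C f m"
  shows "ratio le S \<in> S" "S - {ratio le S} \<in> A_semigroups le C f m"
proof -
  have sub: "submonoid S" "S \<subseteq> C" "f \<in> C - S" "{x \<in> C. less f x} \<subseteq> S"
    and m: "m \<in> S - {0}" "\<forall>x\<in>S - {0}. le m x"
    and A: "\<forall>s\<in>S. \<forall>e\<in>canonical_basis. s + e \<in> S \<and> less s f \<longrightarrow> \<not> less (s + e) f"
    using S unfolding A_semigroups_iff by auto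
  obtain x where x: "x \<in> S" "x \<notin> Delta2 le C f m"
    using Delta2_subset[OF S] ne by blast
  then have "x \<in> S - multiples m" "\<not> less f x" using sub by (auto simp: Delta2_def Delta_def)
  define r where "r = ratio le S"
  have "mult le S = m" using S by (simp add: A_semigroups_def)
  then have r: "r \<in> S - multiples m" "\<And>y. y \<in> S - multiples m \<Longrightarrow> le r y"
    using min_wrt[of "S - multiples m"] sub(2) \<open>x \<in> S - multiples m\<close>
    by (auto simp: r_def ratio_def)
  then show "ratio le S \<in> S" by (simp add: r_def)
  have "le r f"
    using r(2)[OF \<open>x \<in> S - multiples m\<close>] \<open>\<not> less f x\<close> le_trans not_less_iff by blast
  then have rf: "less r f" using r(1) sub(3) by (auto simp: strict_def)
  have "a + b \<noteq> r" if "a \<in> S - {r}" "b \<in> S - {r}" for a b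
  proof
    assume ab: "a + b = r"
    then have "less a r" "less b r"
      using that le_add_self[of a b] le_add_self[of b a] by (auto simp: strict_def add.commute)
    then have "a \<in> multiples m" "b \<in> multiples m"
      using that r(2) not_less_iff by blast+
    then show False using r(1) ab multiples_add by blast
  qed
  moreover have "0 \<noteq> r" using r(1) zero_in_multiples by auto
  ultimately have "submonoid (S - {r})" using sub(1) by (auto simp: submonoid_def)
  moreover have "{x \<in> C. less f x} \<subseteq> S - {r}"
    using sub(4) rf le_antisym unfolding strict_def by blast
  moreover have "m \<noteq> r" using r(1) self_in_multiples by auto
  ultimately show "S - {ratio le S} \<in> A_semigroups le C f m"
    using sub m A unfolding A_semigroups_iff r_def[symmetric] by auto
qed

end

section \<open>Trees given by a parent function\<close>

text \<open>The measure \<open>\<mu>\<close> guarantees that following parents ends; it can only end at \<open>R\<close>. Since every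
  vertex other than \<open>R\<close> has one outgoing edge and \<open>R\<close> has none, no choice is ever made.\<close>

lemma tree_with_root_if_parent:
  fixes G :: "('a, 'a \<times> 'a) pre_digraph" and parent :: "'a \<Rightarrow> 'a" and \<mu> :: "'a \<Rightarrow> nat"
  assumes ends: "tail G = fst" "head G = snd" and root: "R \<in> verts G"
    and arcs: "arcs G = (\<lambda>S. (S, parent S)) ` (verts G - {R})"
    and parent: "\<And>S. S \<in> verts G - {R} \<Longrightarrow> parent S \<in> verts G \<and> \<mu> (parent S) < \<mu> S"
  shows "tree_with_root G R"
proof -
  interpret wf_digraph G
    by unfold_locales (use arcs ends parent in auto)
  have Cons: "awalk S (e # p) R \<longleftrightarrow> S \<in> verts G - {R} \<and> e = (S, parent S) \<and> awalk (parent S) p R"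
    for S e p
    by (auto simp: awalk_Cons_iff arcs ends)
  have "\<exists>!p. awalk S p R" if "S \<in> verts G" for S
    using that
  proof (induction "\<mu> S" arbitrary: S rule: less_induct)
    case less
    show ?case
    proof (cases "S = R")
      case True
      have "awalk S p R \<longleftrightarrow> p = []" for p
        using less.prems True by (cases p) (auto simp: Cons awalk_Nil_iff)
      then show ?thesis by simp
    next
      case False
      then have S: "S \<in> verts G - {R}" using less.prems by simp
      then obtain q where q: "\<And>p. awalk (parent S) p R \<longleftrightarrow> p = q"
        using less.hyps[of "parent S"] parent by metis
      have "awalk S p R \<longleftrightarrow> p = (S, parent S) # q" for p
        using S q by (cases p) (auto simp: Cons awalk_Nil_iff)
      then show ?thesis by simp
    qed
  qed
  then show ?thesis using root by (simp add: tree_with_root_def)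
qed

theorem proposition28:
  fixes C :: "(nat ^ 'p) set"
    and le :: "nat ^ 'p \<Rightarrow> nat ^ 'p \<Rightarrow> bool"
    and f m :: "nat ^ 'p"
  assumes "integer_cone C"
    and "card (extremal_rays C) \<ge> CARD('p)"
    and "monomial_order le"
    and "\<And>k. k \<in> C \<Longrightarrow> finite {x \<in> C. le x k}"
    and "f \<in> C"
    and "m \<in> M_set le C f"
    and "f \<notin> multiples m"
    and "strict le m f \<Longrightarrow> m \<notin> canonical_basis"
  shows "tree_with_root (A_graph le C f m) (Delta2 le C f m)"
proof -
  interpret cone_order C le
    using assms(1,3,4) by unfold_locales
  let ?A = "A_semigroups le C f m" and ?R = "Delta2 le C f m"
  let ?parent = "\<lambda>S. S - {ratio le S}" and ?\<mu> = "\<lambda>S. card (S \<inter> {x \<in> C. le x f})"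
  show ?thesis
  proof (rule tree_with_root_if_parent[where parent = ?parent and \<mu> = ?\<mu>])
    show "?R \<in> verts (A_graph le C f m)"
      using Delta2_in_A_semigroups assms by (simp add: A_graph_def)
    (* An edge from ?R would lead to a vertex, which contains ?R; as it arises by removing
       an element it would equal ?R, and edges join distinct vertices. *)
    show "arcs (A_graph le C f m) = (\<lambda>S. (S, ?parent S)) ` (verts (A_graph le C f m) - {?R})"
      using remove_ratio Delta2_subset[of "?parent ?R" f m] by (fastforce simp: A_graph_def)
    fix S assume "S \<in> verts (A_graph le C f m) - {?R}"
    then have S: "S \<in> ?A" "S \<noteq> ?R" by (auto simp: A_graph_def)
    note r = remove_ratio[OF S]
    have "le (ratio le S) f"
      using r S not_less_iff[of f "ratio le S"] by (auto simp: A_semigroups_iff)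
    moreover have "finite (S \<inter> {x \<in> C. le x f})" using finite_below assms(5) by simp
    moreover have "ratio le S \<in> C" using r(1) S(1) by (auto simp: A_semigroups_iff)
    ultimately have "?\<mu> (?parent S) < ?\<mu> S"
      using r(1) by (intro psubset_card_mono) auto
    then show "?parent S \<in> verts (A_graph le C f m) \<and> ?\<mu> (?parent S) < ?\<mu> S"
      using r(2) by (simp add: A_graph_def)
  qed (simp_all add: A_graph_def)
qed

end
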